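(* Let $\mathbb I=[0,1]$, $Q=\mathbb I\times\mathbb I$, $m$ Lebesgue measure, and let $F:Q\to Q$ be a Borel function of the form $F(x,y)=(T(x),G(x,y))$. Let $\mu$ be an $F$-invariant probability measure with marginal $\mu_x$ on the $x$-axis which is $T$-invariant (and absolutely continuous with respect to Lebesgue measure). Suppose that (1) $(T,\mu_x)$ has exponential convergence to equilibrium with respect to the $L^\infty$ norm $\|\cdot\|_\infty$ and a norm denoted $\|\cdot\|_{\_}$, that is, there are $C_0,\Lambda_0\in\mathbb R^+$, $\Lambda_0<1$, with $$\left|\int f\cdot(g\circ T^n)\,dm-\int g\,d\mu_x\int f\,dm\right|\le C_0\Lambda_0^n\|g\|_\infty\|f\|_{\_},\quad n\ge1,$$ for $f\in L^1(m)$, $g\in L^1(\mu_x)$; (2) $T$ is nonsingular with respect to Lebesgue measure, piecewise continuous and monotonic: there is a finite collection of intervals $\{I_i\}_{i=1,\dots,k}$ with $\bigcup_i I_i=\mathbb I$ such that on each $I_i$, $T$ is a homeomorphism onto its image; (3) $F$ is a contraction on each vertical leaf: $G$ is $\lambda$-Lipschitz in $y$ with $\lambda<1$. Then $(F,\mu)$ has exponential convergence to equilibrium in the following sense: there are $C,\Lambda\in\mathbb R^+$, $\Lambda<1$, such that for each $f\ge0$, each $g$ and each $n\ge1$ $$\left|\int f\cdot(g\circ F^n)\,dm-\int g\,d\mu\int f\,dm\right|\le C\Lambda^n\,\|g\|_{\updownarrow lip}\,\big(\|\pi(f)\|_{\_}+\|f\|_1\big).$$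
   Context: For $g:Q\to\mathbb R$ (measurable), $\|g\|_{\updownarrow lip}=\|g\|_{\infty!}+\operatorname{Lip}_y(g)$, where $\|g\|_{\infty!}=\sup_{x,y\in[0,1]}|g(x,y)|$ (a true supremum over all points) and $\operatorname{Lip}_y(g)=\sup_{x,\,y_1\ne y_2}\frac{|g(x,y_2)-g(x,y_1)|}{|y_2-y_1|}$. For integrable $f:Q\to\mathbb R$, $\pi(f):\mathbb I\to\mathbb R$ is $\pi(f)(x)=\int_{\mathbb I}f(x,t)\,dt$. $\|\cdot\|_1$ is the $L^1(m)$ norm. The norm $\|\cdot\|_{\_}$ is a given norm on a vector space of integrable functions on $\mathbb I$; the estimates are understood as void (right-hand side $+\infty$) when a norm is infinite or undefined. *)

theory Defs
  imports "HOL-Probability.Essential_Supremum" "HOL-Probability.Probability_Measure"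
begin

abbreviation unit_interval :: "real set" where
  "unit_interval \<equiv> {0..1}"

abbreviation unit_square :: "(real \<times> real) set" where
  "unit_square \<equiv> unit_interval \<times> unit_interval"

text \<open>Functions on the unit interval or square are total functions on the ambient type, and only
  their values on the interval or square matter. Maps and observables are Borel; densities are
  only assumed Lebesgue integrable.\<close>

abbreviation borel_I :: "real measure" where
  "borel_I \<equiv> restrict_space borel unit_interval"

abbreviation borel_Q :: "(real \<times> real) measure" where
  "borel_Q \<equiv> restrict_space borel unit_square"

abbreviation leb_I :: "real measure" where
  "leb_I \<equiv> lebesgue_on unit_interval"

abbreviation leb_Q :: "(real \<times> real) measure" where
  "leb_Q \<equiv> lebesgue_on unit_square"

text \<open>A norm \<open>N\<close> on a vector space \<open>V\<close> of integrable functions on the unit interval. Definiteness is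
  required up to Lebesgue null sets, so that norms on spaces of functions and norms on spaces of
  a.e.-equivalence classes are both covered. The second clause says that membership in \<open>V\<close> and
  the value of \<open>N\<close> do not depend on the values taken outside the unit interval. A function
  outside \<open>V\<close> is one whose norm is infinite or undefined.\<close>

definition norm_on_integrable_space :: "(real \<Rightarrow> real) set \<Rightarrow> ((real \<Rightarrow> real) \<Rightarrow> real) \<Rightarrow> bool" where
  "norm_on_integrable_space V N \<longleftrightarrow>
     (\<forall>f\<in>V. integrable leb_I f) \<and>
     (\<forall>f\<in>V. \<forall>g. (\<forall>x\<in>unit_interval. g x = f x) \<longrightarrow> g \<in> V \<and> N g = N f) \<and>
     (\<lambda>x. 0) \<in> V \<and>
     (\<forall>f\<in>V. \<forall>g\<in>V. (\<lambda>x. f x + g x) \<in> V) \<and>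
     (\<forall>c. \<forall>f\<in>V. (\<lambda>x. c * f x) \<in> V) \<and>
     (\<forall>f\<in>V. 0 \<le> N f) \<and>
     (\<forall>f\<in>V. N f = 0 \<longrightarrow> (AE x in leb_I. f x = 0)) \<and>
     (\<forall>c. \<forall>f\<in>V. N (\<lambda>x. c * f x) = \<bar>c\<bar> * N f) \<and>
     (\<forall>f\<in>V. \<forall>g\<in>V. N (\<lambda>x. f x + g x) \<le> N f + N g)"

text \<open>The \<open>L\<^sup>\<infinity>\<close> norm is the essential supremum with respect to Lebesgue measure; it may be infinite.\<close>

definition Linfty_norm :: "(real \<Rightarrow> real) \<Rightarrow> ereal" where
  "Linfty_norm g = esssup leb_I (\<lambda>x. ereal \<bar>g x\<bar>)"

definition L1_norm :: "(real \<times> real \<Rightarrow> real) \<Rightarrow> real" where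
  "L1_norm f = (LINT p|leb_Q. \<bar>f p\<bar>)"

definition true_sup_norm :: "(real \<times> real \<Rightarrow> real) \<Rightarrow> ereal" where
  "true_sup_norm g = (SUP p\<in>unit_square. ereal \<bar>g p\<bar>)"

definition Lip_y :: "(real \<times> real \<Rightarrow> real) \<Rightarrow> ereal" where
  "Lip_y g = (SUP (x, y1, y2) \<in> {(x, y1, y2). x \<in> unit_interval \<and> y1 \<in> unit_interval \<and>
                y2 \<in> unit_interval \<and> y1 \<noteq> y2}.
              ereal (\<bar>g (x, y2) - g (x, y1)\<bar> / \<bar>y2 - y1\<bar>))"

definition updown_lip_norm :: "(real \<times> real \<Rightarrow> real) \<Rightarrow> ereal" where
  "updown_lip_norm g = true_sup_norm g + Lip_y g"

definition fiber_integral :: "(real \<times> real \<Rightarrow> real) \<Rightarrow> real \<Rightarrow> real" where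
  "fiber_integral f x = (LINT t|leb_I. f (x, t))"

definition exp_conv_to_equilibrium ::
  "(real \<Rightarrow> real) \<Rightarrow> real measure \<Rightarrow> (real \<Rightarrow> real) set \<Rightarrow> ((real \<Rightarrow> real) \<Rightarrow> real) \<Rightarrow> bool" where
  "exp_conv_to_equilibrium T \<nu> V N \<longleftrightarrow>
     (\<exists>C \<Lambda>. 0 < C \<and> 0 < \<Lambda> \<and> \<Lambda> < 1 \<and>
       (\<forall>f\<in>V. \<forall>g. integrable \<nu> g \<longrightarrow> Linfty_norm g < \<infinity> \<longrightarrow> (\<forall>n::nat\<ge>1.
          ereal \<bar>(LINT x|leb_I. f x * g ((T ^^ n) x)) - (LINT x|\<nu>. g x) * (LINT x|leb_I. f x)\<bar>
            \<le> ereal (C * \<Lambda> ^ n) * Linfty_norm g * ereal (N f))))"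

definition nonsingular_map :: "(real \<Rightarrow> real) \<Rightarrow> bool" where
  "nonsingular_map T \<longleftrightarrow> T \<in> borel_I \<rightarrow>\<^sub>M borel_I \<and>
     (\<forall>A\<in>null_sets (restrict_space lborel unit_interval).
        T -` A \<inter> unit_interval \<in> null_sets (restrict_space lborel unit_interval))"

definition piecewise_cont_monotonic :: "(real \<Rightarrow> real) \<Rightarrow> bool" where
  "piecewise_cont_monotonic T \<longleftrightarrow>
     (\<exists>(k::nat) I. (\<forall>i\<in>{1..k}. is_interval (I i)) \<and> (\<Union>i\<in>{1..k}. I i) = unit_interval \<and>
        (\<forall>i\<in>{1..k}. \<exists>S. homeomorphism (I i) (T ` I i) T S))"

end

theory Submission
  imports Defs
begin

text \<open>Write \<open>n = k + m\<close> with \<open>k = n div 2\<close>. By contraction \<open>h = g \<circ> F\<^sup>k\<close> oscillates by at most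
  \<open>L * lam ^ k\<close> on every vertical leaf, so up to that error \<open>h\<close> is the function \<open>\<phi> x = h (x, 0)\<close> of the
  base variable alone. Then Fubini turns \<open>\<integral> f (\<phi> \<circ> T\<^sup>m \<circ> fst)\<close> into \<open>\<integral> \<pi>(f) (\<phi> \<circ> T\<^sup>m)\<close>, to which the
  hypothesis on \<open>T\<close> applies, and by invariance \<open>\<integral> \<phi> d\<mu>\<^sub>x\<close> is within the same error of \<open>\<integral> g d\<mu>\<close>.\<close>


section \<open>Lebesgue measurability and Fubini on the unit square\<close>

lemma measurable_lebesgue_on_if_borel:
  fixes f :: "'a::euclidean_space \<Rightarrow> 'b"
  assumes "f \<in> restrict_space borel S \<rightarrow>\<^sub>M M"
  shows "f \<in> lebesgue_on S \<rightarrow>\<^sub>M M"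
proof -
  have "(\<lambda>x. x) \<in> lebesgue_on S \<rightarrow>\<^sub>M restrict_space borel S"
    by (rule measurable_restrict_space3) (auto intro: measurable_completion)
  from measurable_compose[OF this assms] show ?thesis .
qed

text \<open>Fubini's theorem is available for \<open>lborel \<Otimes>\<^sub>M lborel\<close>, whose
  measurable functions are Borel, whereas \<open>f\<close> is only Lebesgue measurable. So
  \<open>f\<close> is replaced by a Borel function \<open>f1\<close> equal to it almost everywhere,
  and the completion is handled separately on the plane, on the slices and on the base.\<close>

lemma integral_leb_Q_eq_integral_fiber:
  assumes f: "integrable leb_Q f"
  shows "(LINT p|leb_Q. f p) = (LINT x|leb_I. fiber_integral f x)"
proof -
  \<comment> \<open>Extension by zero moves the integral to the whole plane.\<close>
  define f0 where "f0 p = indicator unit_square p *\<^sub>R f p" for p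
  have Q: "unit_square \<in> sets lebesgue"
    by (intro sets_completionI_sets) (simp add: borel_closed closed_Times)
  have I: "unit_interval \<in> sets lebesgue" by simp
  have f0: "integrable lebesgue f0"
    using f Q by (simp add: f0_def[abs_def] integrable_restrict_space)
  then obtain f1 where f1: "f1 \<in> borel_measurable lborel" and AE: "AE p in lborel. f0 p = f1 p"
    using completion_ex_borel_measurable_real[of f0 lborel] by blast
  have f1': "f1 \<in> borel_measurable lebesgue" using f1 by (rule measurable_completion)
  have AE': "AE p in lebesgue. f0 p = f1 p" using AE by (rule AE_completion)
  have "integrable lebesgue f1"
    using f0 integrable_cong_AE[OF borel_measurable_integrable[OF f0] f1' AE'] by simp
  then have int1: "integrable lborel f1" using f1 by (simp add: integrable_completion)
  have meas: "f1 \<in> borel_measurable (lborel \<Otimes>\<^sub>M lborel)" using f1 by (simp add: lborel_prod)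
  have slice: "AE x in lborel. (LINT y|lborel. f1 (x, y)) = indicator unit_interval x *\<^sub>R fiber_integral f x"
  proof -
    have "AE p in lborel \<Otimes>\<^sub>M lborel. f0 p = f1 p"
      using AE by (simp only: lborel_prod)
    \<comment> \<open>A null set of the plane meets almost every vertical line in a null
      set.\<close>
    then have "AE x in lborel. AE y in lborel. f0 (x, y) = f1 (x, y)"
      by (rule lborel_pair.AE_pair)
    then show ?thesis
    proof eventually_elim
      case (elim x)
      have m1: "(\<lambda>y. f1 (x, y)) \<in> borel_measurable lborel"
        using meas by measurable
      then have m1': "(\<lambda>y. f1 (x, y)) \<in> borel_measurable lebesgue" by (rule measurable_completion)
      have ae: "AE y in lebesgue. f1 (x, y) = f0 (x, y)"
        using elim by (intro AE_completion) (auto elim: eventually_mono)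
      \<comment> \<open>A slice of a Lebesgue measurable function need not be measurable. For the
        present \<open>x\<close> it is, since it agrees almost everywhere with a Borel slice and
        \<open>lebesgue\<close> is complete. The same argument later gives measurability of
        \<open>fiber_integral f\<close> on the base.\<close>
      have m0: "(\<lambda>y. f0 (x, y)) \<in> borel_measurable lebesgue"
        by (rule borel_measurable_AE[OF m1' ae])
      have "(LINT y|lborel. f1 (x, y)) = (LINT y|lebesgue. f1 (x, y))"
        by (rule integral_completion[OF m1, symmetric])
      also have "\<dots> = (LINT y|lebesgue. f0 (x, y))"
        by (rule integral_cong_AE[OF m1' m0 ae])
      also have "\<dots> = (LINT y|lebesgue. indicator unit_interval x *\<^sub>R (indicator unit_interval y *\<^sub>R f (x, y)))"
        by (intro Bochner_Integration.integral_cong) (auto simp: f0_def indicator_def)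
      also have "\<dots> = indicator unit_interval x *\<^sub>R fiber_integral f x"
        using I by (simp add: fiber_integral_def integral_restrict_space)
      finally show ?case .
    qed
  qed
  have mi: "(\<lambda>x. LINT y|lborel. f1 (x, y)) \<in> borel_measurable lborel"
    using meas by measurable
  then have mi': "(\<lambda>x. LINT y|lborel. f1 (x, y)) \<in> borel_measurable lebesgue"
    by (rule measurable_completion)
  have slice': "AE x in lebesgue. (LINT y|lborel. f1 (x, y)) = indicator unit_interval x *\<^sub>R fiber_integral f x"
    using slice by (rule AE_completion)
  have "(LINT p|leb_Q. f p) = (LINT p|lebesgue. f0 p)"
    using Q by (simp add: f0_def integral_restrict_space)
  also have "\<dots> = (LINT p|lborel. f1 p)"
    using integral_cong_AE[OF borel_measurable_integrable[OF f0] f1' AE'] f1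
    by (simp add: integral_completion)
  also have "\<dots> = (LINT x|lborel. LINT y|lborel. f1 (x, y))"
    using lborel_pair.integral_fst'[of f1] int1 by (simp add: lborel_prod)
  also have "\<dots> = (LINT x|lebesgue. LINT y|lborel. f1 (x, y))"
    by (rule integral_completion[OF mi, symmetric])
  also have "\<dots> = (LINT x|lebesgue. indicator unit_interval x *\<^sub>R fiber_integral f x)"
    by (rule integral_cong_AE[OF mi' borel_measurable_AE[OF mi' slice'] slice'])
  also have "\<dots> = (LINT x|leb_I. fiber_integral f x)"
    using I by (simp add: integral_restrict_space)
  finally show ?thesis .
qed

lemma fiber_integral_mult_fst:
  "fiber_integral (\<lambda>p. f p * \<phi> (fst p)) x = fiber_integral f x * \<phi> x"
  by (simp add: fiber_integral_def)

section \<open>Real constants from a finite norm, and the rate at half time\<close>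

lemma updown_lip_norm_finiteE:
  assumes "updown_lip_norm g < \<infinity>"
  obtains S L where "0 \<le> S" "0 \<le> L" "updown_lip_norm g = ereal (S + L)"
    "\<And>p. p \<in> unit_square \<Longrightarrow> \<bar>g p\<bar> \<le> S"
    "\<And>x y1 y2. x \<in> unit_interval \<Longrightarrow> y1 \<in> unit_interval \<Longrightarrow> y2 \<in> unit_interval \<Longrightarrow>
       \<bar>g (x, y2) - g (x, y1)\<bar> \<le> L * \<bar>y2 - y1\<bar>"
proof -
  have ubS: "ereal \<bar>g p\<bar> \<le> true_sup_norm g" if "p \<in> unit_square" for p
    unfolding true_sup_norm_def using that by (rule SUP_upper)
  have ubL: "ereal (\<bar>g (x, y2) - g (x, y1)\<bar> / \<bar>y2 - y1\<bar>) \<le> Lip_y g"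
    if "x \<in> unit_interval" "y1 \<in> unit_interval" "y2 \<in> unit_interval" "y1 \<noteq> y2" for x y1 y2
    unfolding Lip_y_def using that by (intro SUP_upper2[of "(x, y1, y2)"]) auto
  have S0: "0 \<le> true_sup_norm g"
    using ubS[of "(0, 0)"] by (auto intro: order_trans[rotated])
  have L0: "0 \<le> Lip_y g"
    using ubL[of 0 0 1] by (auto intro: order_trans[rotated])
  \<comment> \<open>Both summands are nonnegative, so neither can be infinite when the sum is below
    \<infinity>.\<close>
  obtain S L where S: "true_sup_norm g = ereal S" and L: "Lip_y g = ereal L"
    using assms S0 L0 unfolding updown_lip_norm_def
    by (cases "true_sup_norm g"; cases "Lip_y g") auto
  show thesis
  proof (rule that[of S L])
    show "\<bar>g (x, y2) - g (x, y1)\<bar> \<le> L * \<bar>y2 - y1\<bar>"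
      if "x \<in> unit_interval" "y1 \<in> unit_interval" "y2 \<in> unit_interval" for x y1 y2
    proof (cases "y1 = y2")
      case False
      then show ?thesis using ubL[OF that False] L by (simp add: divide_le_eq)
    qed simp
  qed (use S L S0 L0 ubS in \<open>auto simp: updown_lip_norm_def\<close>)
qed

text \<open>Since \<open>2 * (n div 2) + 1\<close> is at least \<open>n\<close>, rounding down costs
  at most one factor \<open>sqrt \<theta>\<close>, which the division pays for.\<close>

lemma geometric_rate_half:
  fixes \<theta> :: real
  assumes "0 < \<theta>" "\<theta> < 1"
  shows "\<theta> ^ (n div 2) \<le> sqrt \<theta> ^ n / sqrt \<theta>"
proof -
  have "sqrt \<theta> * \<theta> ^ (n div 2) = sqrt \<theta> ^ Suc (2 * (n div 2))"
    using assms by (simp add: power_mult)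
  also have "\<dots> \<le> sqrt \<theta> ^ n"
    using assms by (intro power_decreasing) auto
  finally show ?thesis using assms by (simp add: field_simps)
qed

section \<open>Integrals of products with bounded or nearby factors\<close>

lemma integral_mult_diff_bound:
  fixes f u v :: "'a \<Rightarrow> real"
  assumes f: "integrable M f" and fu: "integrable M (\<lambda>x. f x * u x)"
    and fv: "integrable M (\<lambda>x. f x * v x)"
    and close: "\<And>x. x \<in> space M \<Longrightarrow> \<bar>u x - v x\<bar> \<le> e"
  shows "\<bar>(LINT x|M. f x * u x) - (LINT x|M. f x * v x)\<bar> \<le> e * (LINT x|M. \<bar>f x\<bar>)"
proof -
  have "\<bar>(LINT x|M. f x * u x) - (LINT x|M. f x * v x)\<bar> = \<bar>LINT x|M. f x * (u x - v x)\<bar>"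
    using fu fv by (simp add: right_diff_distrib)
  also have "\<dots> \<le> (LINT x|M. e * \<bar>f x\<bar>)"
  proof (rule order_trans[OF integral_abs_bound integral_mono])
    show "integrable M (\<lambda>x. \<bar>f x * (u x - v x)\<bar>)"
      using fu fv by (simp add: right_diff_distrib)
    show "\<bar>f x * (u x - v x)\<bar> \<le> e * \<bar>f x\<bar>" if "x \<in> space M" for x
      using mult_right_mono[OF close[OF that], of "\<bar>f x\<bar>"] by (simp add: abs_mult mult.commute)
  qed (use f in simp)
  finally show ?thesis by simp
qed

lemma integrable_mult_bounded:
  fixes f u :: "'a \<Rightarrow> real"
  assumes f: "integrable M f" and u: "u \<in> borel_measurable M"
    and bd: "\<And>x. x \<in> space M \<Longrightarrow> \<bar>u x\<bar> \<le> B"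
  shows "integrable M (\<lambda>x. f x * u x)"
proof (rule Bochner_Integration.integrable_bound)
  show "integrable M (\<lambda>x. B * f x)" using f by simp
  show "(\<lambda>x. f x * u x) \<in> borel_measurable M" using f u by simp
  have "norm (f x * u x) \<le> norm (B * f x)" if "x \<in> space M" for x
    using mult_left_mono[OF order_trans[OF bd[OF that] abs_ge_self], of "\<bar>f x\<bar>"]
    by (simp add: abs_mult mult.commute)
  then show "AE x in M. norm (f x * u x) \<le> norm (B * f x)" by simp
qed

section \<open>Iterates of maps and of skew products\<close>

lemma measurable_funpow:
  assumes "f \<in> M \<rightarrow>\<^sub>M M"
  shows "(f ^^ n) \<in> M \<rightarrow>\<^sub>M M"
  by (induction n) (use assms in \<open>auto intro: measurable_comp\<close>)

lemma distr_funpow_eq: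
  assumes f: "f \<in> M \<rightarrow>\<^sub>M M" and inv: "distr M M f = M"
  shows "distr M M (f ^^ n) = M"
proof (induction n)
  case 0
  then show ?case by (simp add: distr_id2)
next
  case (Suc n)
  then show ?case
    using distr_distr[OF f measurable_funpow[OF f, of n]] inv by (simp add: comp_def)
qed

lemma skew_product_iterate:
  assumes F_form: "\<And>x y. x \<in> A \<Longrightarrow> y \<in> B \<Longrightarrow> F (x, y) = (T x, G (x, y))"
    and F_maps: "\<And>p. p \<in> A \<times> B \<Longrightarrow> F p \<in> A \<times> B"
    and p: "p \<in> A \<times> B"
  shows "(F ^^ n) p \<in> A \<times> B" and "fst ((F ^^ n) p) = (T ^^ n) (fst p)"
proof -
  \<comment> \<open>Both claims go through one induction: the skew form of \<open>F\<close> is known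
    only on \<open>A \<times> B\<close>, so the orbit must be seen to stay there.\<close>
  have "(F ^^ n) p \<in> A \<times> B \<and> fst ((F ^^ n) p) = (T ^^ n) (fst p)"
  proof (induction n)
    case (Suc n)
    then obtain x y where xy: "(F ^^ n) p = (x, y)" "x \<in> A" "y \<in> B" "x = (T ^^ n) (fst p)"
      by (metis SigmaE fst_conv)
    then show ?case using F_maps[of "(x, y)"] F_form[of x y] by simp
  qed (use p in simp)
  then show "(F ^^ n) p \<in> A \<times> B" "fst ((F ^^ n) p) = (T ^^ n) (fst p)" by auto
qed

text \<open>Two points of one leaf have the same base orbit. Hence their images always share a leaf,
  where each application of \<open>G\<close> gains another factor \<open>lam\<close>.\<close>

lemma skew_product_iterate_contracts:
  fixes B :: "real set"
  assumes F_form: "\<And>x y. x \<in> A \<Longrightarrow> y \<in> B \<Longrightarrow> F (x, y) = (T x, G (x, y))"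
    and F_maps: "\<And>p. p \<in> A \<times> B \<Longrightarrow> F p \<in> A \<times> B"
    and G: "\<And>x. x \<in> A \<Longrightarrow> lam-lipschitz_on B (\<lambda>y. G (x, y))"
    and x: "x \<in> A" and y: "y \<in> B" "y' \<in> B"
  shows "\<bar>snd ((F ^^ n) (x, y)) - snd ((F ^^ n) (x, y'))\<bar> \<le> lam ^ n * \<bar>y - y'\<bar>"
proof (induction n)
  case (Suc n)
  have it: "(F ^^ n) p \<in> A \<times> B" "fst ((F ^^ n) p) = (T ^^ n) (fst p)" if "p \<in> A \<times> B" for p
    by (rule skew_product_iterate[where F = F and T = T and G = G and A = A and B = B]; fact)+
  obtain u v where uv: "(F ^^ n) (x, y) = (u, v)" "u \<in> A" "v \<in> B" "u = (T ^^ n) x"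
    using it[of "(x, y)"] x y by (cases "(F ^^ n) (x, y)") auto
  obtain v' where uv': "(F ^^ n) (x, y') = (u, v')" "v' \<in> B"
    using it[of "(x, y')"] x y uv(4) by (cases "(F ^^ n) (x, y')") auto
  have "\<bar>G (u, v) - G (u, v')\<bar> \<le> lam * \<bar>v - v'\<bar>"
    using lipschitz_onD[OF G[OF uv(2)] uv(3) uv'(2)] by (simp add: dist_real_def)
  also have "\<dots> \<le> lam * (lam ^ n * \<bar>y - y'\<bar>)"
    using Suc uv uv' lipschitz_on_nonneg[OF G[OF x]] by (intro mult_left_mono) auto
  finally show ?case using uv uv' F_form by (simp add: mult.assoc)
qed simp

section \<open>Exponential convergence for the skew product\<close>

theorem theorem1:
  fixes F :: "real \<times> real \<Rightarrow> real \<times> real"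
    and T :: "real \<Rightarrow> real"
    and G :: "real \<times> real \<Rightarrow> real"
    and \<mu> :: "(real \<times> real) measure"
    and \<mu>x :: "real measure"
    and V :: "(real \<Rightarrow> real) set"
    and N :: "(real \<Rightarrow> real) \<Rightarrow> real"
    and lam :: real
  assumes F_borel: "F \<in> borel_Q \<rightarrow>\<^sub>M borel_Q"
    and F_form: "\<And>x y. x \<in> unit_interval \<Longrightarrow> y \<in> unit_interval \<Longrightarrow> F (x, y) = (T x, G (x, y))"
    and mu_prob: "prob_space \<mu>"
    and mu_sets: "sets \<mu> = sets borel_Q"
    and mu_inv: "distr \<mu> \<mu> F = \<mu>"
    and marginal: "\<mu>x = distr \<mu> borel_I fst"
    and mux_inv: "distr \<mu>x \<mu>x T = \<mu>x"
    and mux_ac: "absolutely_continuous (restrict_space lborel unit_interval) \<mu>x"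
    and norm_N: "norm_on_integrable_space V N"
    and conv_T: "exp_conv_to_equilibrium T \<mu>x V N"
    and T_nonsing: "nonsingular_map T"
    and T_piecewise: "piecewise_cont_monotonic T"
    and G_contr: "\<And>x. x \<in> unit_interval \<Longrightarrow> lam-lipschitz_on unit_interval (\<lambda>y. G (x, y))"
    and lam_less: "lam < 1"
  shows "\<exists>C \<Lambda>. 0 < C \<and> 0 < \<Lambda> \<and> \<Lambda> < 1 \<and>
    (\<forall>f g. integrable leb_Q f \<longrightarrow> (\<forall>p\<in>unit_square. 0 \<le> f p) \<longrightarrow> fiber_integral f \<in> V \<longrightarrow>
           g \<in> borel_measurable borel_Q \<longrightarrow> updown_lip_norm g < \<infinity> \<longrightarrow> (\<forall>n::nat\<ge>1.
       ereal \<bar>(LINT p|leb_Q. f p * g ((F ^^ n) p)) - (LINT p|\<mu>. g p) * (LINT p|leb_Q. f p)\<bar>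
         \<le> ereal (C * \<Lambda> ^ n) * updown_lip_norm g * ereal (N (fiber_integral f) + L1_norm f)))"
proof -
  obtain C0 \<Lambda>0 where C0: "0 < C0" "0 < \<Lambda>0" "\<Lambda>0 < 1" and
    conv: "\<And>f g n. f \<in> V \<Longrightarrow> integrable \<mu>x g \<Longrightarrow> Linfty_norm g < \<infinity> \<Longrightarrow> 1 \<le> n \<Longrightarrow>
      ereal \<bar>(LINT x|leb_I. f x * g ((T ^^ n) x)) - (LINT x|\<mu>x. g x) * (LINT x|leb_I. f x)\<bar>
        \<le> ereal (C0 * \<Lambda>0 ^ n) * Linfty_norm g * ereal (N f)"
    using conv_T unfolding exp_conv_to_equilibrium_def by blast
  have lam0: "0 \<le> lam" using lipschitz_on_nonneg[OF G_contr[of 0]] by simp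
  \<comment> \<open>A common rate for base and leaves. It is positive even if
    \<open>lam = 0\<close>, so dividing by its square root is legitimate.\<close>
  define \<theta> where "\<theta> = max \<Lambda>0 lam"
  have \<theta>: "0 < \<theta>" "\<theta> < 1" "\<Lambda>0 \<le> \<theta>" "lam \<le> \<theta>"
    using C0 lam_less by (auto simp: \<theta>_def)
  define \<Lambda> where "\<Lambda> = sqrt \<theta>"
  \<comment> \<open>\<open>C0\<close> comes from the base; the 2 counts the two replacements of
    \<open>h\<close> by \<open>\<phi>\<close>, once under the Lebesgue integral and once under
    \<mu>; the denominator pays for rounding in \<open>n div 2\<close>.\<close>
  define C where "C = (C0 + 2) / \<Lambda>"
  have \<Lambda>: "0 < \<Lambda>" "\<Lambda> < 1" using \<theta> by (auto simp: \<Lambda>_def)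
  have C: "0 < C" using C0 \<Lambda> by (simp add: C_def)
  interpret prob_space \<mu> by (rule mu_prob)
  have space_\<mu>: "space \<mu> = unit_square"
    using sets_eq_imp_space_eq[OF mu_sets] by (simp add: space_restrict_space)
  have T_meas: "T \<in> borel_I \<rightarrow>\<^sub>M borel_I" using T_nonsing by (simp add: nonsingular_map_def)
  have F_maps: "F p \<in> unit_square" if "p \<in> unit_square" for p
    using measurable_space[OF F_borel, of p] that by (simp add: space_restrict_space)
  have it: "(F ^^ n) p \<in> unit_square" "fst ((F ^^ n) p) = (T ^^ n) (fst p)"
    if "p \<in> unit_square" for p n
    by (rule skew_product_iterate[where F = F and T = T and G = G and A = unit_interval
          and B = unit_interval]; fact)+
  have contracts: "\<bar>snd ((F ^^ n) (x, y)) - snd ((F ^^ n) (x, y'))\<bar> \<le> lam ^ n * \<bar>y - y'\<bar>"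
    if "x \<in> unit_interval" "y \<in> unit_interval" "y' \<in> unit_interval" for x y y' n
    by (rule skew_product_iterate_contracts[where F = F and T = T and G = G
          and A = unit_interval and B = unit_interval]; fact)
  have F_\<mu>: "F \<in> \<mu> \<rightarrow>\<^sub>M \<mu>"
    using F_borel by (simp cong: measurable_cong_sets add: measurable_cong_sets[OF mu_sets mu_sets])
  have fst_Q: "fst \<in> borel_Q \<rightarrow>\<^sub>M borel_I"
    by (rule measurable_restrict_space3) (auto simp: borel_prod[symmetric])
  have fst_\<mu>: "fst \<in> \<mu> \<rightarrow>\<^sub>M borel_I"
    using fst_Q by (simp add: measurable_cong_sets[OF mu_sets refl])
  have section_Q: "(\<lambda>x. (x, 0)) \<in> borel_I \<rightarrow>\<^sub>M borel_Q"
    by (rule measurable_restrict_space3) (auto simp: borel_prod[symmetric])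
  have bound: "ereal \<bar>(LINT p|leb_Q. f p * g ((F ^^ n) p)) - (LINT p|\<mu>. g p) * (LINT p|leb_Q. f p)\<bar>
         \<le> ereal (C * \<Lambda> ^ n) * updown_lip_norm g * ereal (N (fiber_integral f) + L1_norm f)"
    if f: "integrable leb_Q f" and fV: "fiber_integral f \<in> V"
      and g: "g \<in> borel_measurable borel_Q" and g_fin: "updown_lip_norm g < \<infinity>" and n: "1 \<le> n"
    for f g and n :: nat
  proof -
    obtain S L where SL: "0 \<le> S" "0 \<le> L" "updown_lip_norm g = ereal (S + L)"
      and gS: "\<And>p. p \<in> unit_square \<Longrightarrow> \<bar>g p\<bar> \<le> S"
      and gL: "\<And>x y1 y2. x \<in> unit_interval \<Longrightarrow> y1 \<in> unit_interval \<Longrightarrow> y2 \<in> unit_interval \<Longrightarrow>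
         \<bar>g (x, y2) - g (x, y1)\<bar> \<le> L * \<bar>y2 - y1\<bar>"
      using updown_lip_norm_finiteE[OF g_fin] by blast
    define k where "k = n div 2"
    define m where "m = n - k"
    \<comment> \<open>Rounding down gives the larger half to \<open>m\<close>. Thus \<open>m\<close>
      is positive even for \<open>n = 1\<close>, as the hypothesis on \<open>T\<close> demands, and
      \<open>\<theta> ^ m \<le> \<theta> ^ k\<close>.\<close>
    have nkm: "n = k + m" "1 \<le> m" "k \<le> m" using n by (auto simp: k_def m_def)
    define h where "h p = g ((F ^^ k) p)" for p
    define \<phi> where "\<phi> x = h (x, 0)" for x
    define e where "e = L * lam ^ k"
    have h_meas: "h \<in> borel_measurable borel_Q"
      unfolding h_def by (rule measurable_compose[OF measurable_funpow[OF F_borel] g])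
    have \<phi>_meas: "\<phi> \<in> borel_measurable borel_I"
      unfolding \<phi>_def by (rule measurable_compose[OF section_Q h_meas])
    have hS: "\<bar>h p\<bar> \<le> S" if "p \<in> unit_square" for p
      unfolding h_def by (intro gS it that)
    have \<phi>S: "\<bar>\<phi> x\<bar> \<le> S" if "x \<in> unit_interval" for x
      unfolding \<phi>_def using that by (intro hS) auto
    \<comment> \<open>The point \<open>p\<close> and the foot of its leaf are at distance at most 1,
      hence at most \<open>lam ^ k\<close> after \<open>k\<close> steps; the Lipschitz constant
      \<open>L\<close> of \<open>g\<close> along leaves does the rest.\<close>
    have h_\<phi>: "\<bar>h p - \<phi> (fst p)\<bar> \<le> e" if p: "p \<in> unit_square" for p
    proof -
      obtain x y where xy: "p = (x, y)" "x \<in> unit_interval" "y \<in> unit_interval"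
        using p by blast
      obtain u v where uv: "(F ^^ k) (x, y) = (u, v)" "u \<in> unit_interval" "v \<in> unit_interval"
        "u = (T ^^ k) x"
        using it[of "(x, y)" k] xy by (cases "(F ^^ k) (x, y)") auto
      obtain v' where uv': "(F ^^ k) (x, 0) = (u, v')" "v' \<in> unit_interval"
        using it[of "(x, 0)" k] xy uv(4) by (cases "(F ^^ k) (x, 0)") auto
      have "\<bar>v - v'\<bar> \<le> lam ^ k * \<bar>y - 0\<bar>"
        using contracts[of x y 0 k] xy uv uv' by simp
      also have "\<dots> \<le> lam ^ k"
        using xy lam0 by (simp add: mult_left_le)
      finally have "L * \<bar>v - v'\<bar> \<le> e"
        using SL by (simp add: e_def mult_left_mono)
      then show ?thesis
        using gL[of u v' v] uv uv' xy by (simp add: h_def \<phi>_def)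
    qed
    have space_leb: "space leb_Q = unit_square" by (simp add: space_restrict_space)
    \<comment> \<open>Composition is done among Borel maps; only the result is passed to the
      completed measure, where \<open>f\<close> lives.\<close>
    have hF_meas: "(\<lambda>p. h ((F ^^ m) p)) \<in> borel_measurable leb_Q"
      by (intro measurable_lebesgue_on_if_borel
          measurable_compose[OF measurable_funpow[OF F_borel] h_meas])
    have \<phi>T_meas: "(\<lambda>p. \<phi> ((T ^^ m) (fst p))) \<in> borel_measurable leb_Q"
      by (intro measurable_lebesgue_on_if_borel measurable_compose[OF fst_Q]
          measurable_compose[OF measurable_funpow[OF T_meas] \<phi>_meas])
    have T_it: "(T ^^ m) x \<in> unit_interval" if "x \<in> unit_interval" for x
      using measurable_space[OF measurable_funpow[OF T_meas], of x m] that
      by (simp add: space_restrict_space)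
    have int_hF: "integrable leb_Q (\<lambda>p. f p * h ((F ^^ m) p))"
      using it(1) hS by (intro integrable_mult_bounded[OF f hF_meas, of S]) (auto simp: space_leb)
    have int_\<phi>T: "integrable leb_Q (\<lambda>p. f p * \<phi> ((T ^^ m) (fst p)))"
      using T_it \<phi>S by (intro integrable_mult_bounded[OF f \<phi>T_meas, of S]) (auto simp: space_leb)
    have d1: "\<bar>(LINT p|leb_Q. f p * h ((F ^^ m) p)) - (LINT p|leb_Q. f p * \<phi> ((T ^^ m) (fst p)))\<bar>
        \<le> e * L1_norm f"
      unfolding L1_norm_def
    proof (rule integral_mult_diff_bound[OF f int_hF int_\<phi>T])
      show "\<bar>h ((F ^^ m) p) - \<phi> ((T ^^ m) (fst p))\<bar> \<le> e" if "p \<in> space leb_Q" for p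
        using h_\<phi>[of "(F ^^ m) p"] it[of p] that by (simp add: space_leb)
    qed
    have d2: "(LINT p|leb_Q. f p * \<phi> ((T ^^ m) (fst p)))
        = (LINT x|leb_I. fiber_integral f x * \<phi> ((T ^^ m) x))"
      using integral_leb_Q_eq_integral_fiber[OF int_\<phi>T]
        fiber_integral_mult_fst[of f "\<lambda>x. \<phi> ((T ^^ m) x)"] by simp
    \<comment> \<open>The bound is independent of \<open>k\<close>, so the base estimate does not
      deteriorate with the iterates absorbed into \<open>\<phi>\<close>.\<close>
    have Linf: "Linfty_norm \<phi> \<le> ereal S"
      unfolding Linfty_norm_def
    proof (rule esssup_I)
      show "(\<lambda>x. ereal \<bar>\<phi> x\<bar>) \<in> borel_measurable leb_I"
        using measurable_lebesgue_on_if_borel[OF \<phi>_meas] by measurable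
      show "AE x in leb_I. ereal \<bar>\<phi> x\<bar> \<le> ereal S"
        using \<phi>S by (intro AE_I2) (simp add: space_restrict_space)
    qed
    have h_\<mu>: "integrable \<mu> h"
    proof (rule integrable_const_bound[of _ S])
      show "h \<in> borel_measurable \<mu>" using h_meas by (simp add: measurable_cong_sets[OF mu_sets refl])
    qed (use hS space_\<mu> in \<open>auto intro!: AE_I2\<close>)
    have \<phi>_\<mu>: "integrable \<mu> (\<lambda>p. \<phi> (fst p))"
    proof (rule integrable_const_bound[of _ S])
      show "(\<lambda>p. \<phi> (fst p)) \<in> borel_measurable \<mu>" by (rule measurable_compose[OF fst_\<mu> \<phi>_meas])
    qed (use \<phi>S space_\<mu> in \<open>auto intro!: AE_I2\<close>)
    have \<phi>_\<mu>x: "integrable \<mu>x \<phi>"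
      unfolding marginal using \<phi>_\<mu> by (simp add: integrable_distr_eq[OF fst_\<mu> \<phi>_meas])
    have int_\<phi>: "(LINT x|\<mu>x. \<phi> x) = (LINT p|\<mu>. \<phi> (fst p))"
      unfolding marginal by (rule integral_distr[OF fst_\<mu> \<phi>_meas])
    have int_h: "(LINT p|\<mu>. h p) = (LINT p|\<mu>. g p)"
    proof -
      have "g \<in> borel_measurable \<mu>" using g by (simp add: measurable_cong_sets[OF mu_sets refl])
      then have "(LINT p|distr \<mu> \<mu> (F ^^ k). g p) = (LINT p|\<mu>. h p)"
        unfolding h_def by (intro integral_distr measurable_funpow F_\<mu>)
      then show ?thesis by (simp add: distr_funpow_eq[OF F_\<mu> mu_inv])
    qed
    \<comment> \<open>The comparison lemma is used with weight 1, whose integral is 1 because \<mu>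
      is a probability. The closeness of \<open>h\<close> and \<open>\<phi>\<close> holds at every
      point of the square, so it also serves a \<mu> that is singular to Lebesgue measure.\<close>
    have d4: "\<bar>(LINT x|\<mu>x. \<phi> x) - (LINT p|\<mu>. g p)\<bar> \<le> e"
      using integral_mult_diff_bound[of \<mu> "\<lambda>p. 1" h "\<lambda>p. \<phi> (fst p)" e] h_\<mu> \<phi>_\<mu> h_\<phi>
      by (simp add: space_\<mu> int_\<phi> int_h prob_space[unfolded space_\<mu>] abs_minus_commute)
    have N0: "0 \<le> N (fiber_integral f)"
      using norm_N fV unfolding norm_on_integrable_space_def by blast
    have "ereal \<bar>(LINT x|leb_I. fiber_integral f x * \<phi> ((T ^^ m) x))
          - (LINT x|\<mu>x. \<phi> x) * (LINT x|leb_I. fiber_integral f x)\<bar>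
        \<le> ereal (C0 * \<Lambda>0 ^ m) * Linfty_norm \<phi> * ereal (N (fiber_integral f))"
      using Linf by (intro conv fV \<phi>_\<mu>x nkm(2)) auto
    also have "\<dots> \<le> ereal (C0 * \<Lambda>0 ^ m) * ereal S * ereal (N (fiber_integral f))"
      using Linf C0 N0 by (intro ereal_mult_right_mono ereal_mult_left_mono) auto
    finally have d3: "\<bar>(LINT x|leb_I. fiber_integral f x * \<phi> ((T ^^ m) x))
          - (LINT x|\<mu>x. \<phi> x) * (LINT p|leb_Q. f p)\<bar>
        \<le> C0 * \<Lambda>0 ^ m * S * N (fiber_integral f)"
      by (simp add: integral_leb_Q_eq_integral_fiber[OF f])
    have L1: "\<bar>LINT p|leb_Q. f p\<bar> \<le> L1_norm f" "0 \<le> L1_norm f"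
      by (simp_all add: L1_norm_def)
    have "\<bar>(LINT x|\<mu>x. \<phi> x) * (LINT p|leb_Q. f p) - (LINT p|\<mu>. g p) * (LINT p|leb_Q. f p)\<bar>
        \<le> e * L1_norm f"
      unfolding left_diff_distrib[symmetric] abs_mult using d4 L1 by (intro mult_mono) auto
    moreover have "g ((F ^^ n) p) = h ((F ^^ m) p)" for p
      by (simp add: h_def nkm(1) funpow_add)
    \<comment> \<open>Triangle inequality through three errors: \<open>d1\<close>, the base error
      \<open>d3\<close>, and the change of mean from \<open>\<phi>\<close> to \<open>g\<close>. The
      first and last each contribute \<open>e * L1_norm f\<close>.\<close>
    ultimately have "\<bar>(LINT p|leb_Q. f p * g ((F ^^ n) p)) - (LINT p|\<mu>. g p) * (LINT p|leb_Q. f p)\<bar>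
        \<le> C0 * \<Lambda>0 ^ m * S * N (fiber_integral f) + 2 * (e * L1_norm f)"
      using d1 d3 unfolding d2 by simp
    also have "\<dots> \<le> C0 * \<theta> ^ k * (S + L) * N (fiber_integral f) + 2 * (\<theta> ^ k * (S + L) * L1_norm f)"
    proof -
      have "\<Lambda>0 ^ m \<le> \<theta> ^ m" using C0 \<theta> by (intro power_mono) auto
      also have "\<dots> \<le> \<theta> ^ k" using \<theta> nkm by (intro power_decreasing) auto
      finally have "C0 * \<Lambda>0 ^ m * S * N (fiber_integral f)
          \<le> C0 * \<theta> ^ k * (S + L) * N (fiber_integral f)"
        using C0 SL N0 \<theta> by (intro mult_mono mult_nonneg_nonneg) auto
      moreover have "e * L1_norm f \<le> \<theta> ^ k * (S + L) * L1_norm f"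
        unfolding e_def mult.commute[of L] using SL L1 lam0 \<theta>
        by (intro mult_right_mono mult_mono power_mono) auto
      ultimately show ?thesis by simp
    qed
    also have "\<dots> \<le> (C0 + 2) * \<theta> ^ k * ((S + L) * (N (fiber_integral f) + L1_norm f))"
    proof -
      \<comment> \<open>This is exactly the right side minus the left side: the cross terms of the
        product \<open>(C0 + 2) * (N (fiber_integral f) + L1_norm f)\<close>.\<close>
      have "0 \<le> \<theta> ^ k * (S + L) * (2 * N (fiber_integral f) + C0 * L1_norm f)"
        using C0 SL(1,2) N0 L1(2) \<theta>(1) by simp
      then show ?thesis by (simp add: algebra_simps)
    qed
    also have "\<dots> \<le> (C0 + 2) * (\<Lambda> ^ n / \<Lambda>) * ((S + L) * (N (fiber_integral f) + L1_norm f))"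
      unfolding \<Lambda>_def k_def using C0 SL N0 L1 \<theta>
      by (intro mult_right_mono mult_left_mono geometric_rate_half) auto
    finally show ?thesis by (simp add: SL(3) C_def mult_ac)
  qed
  show ?thesis
    by (intro exI[of _ C] exI[of _ \<Lambda>] conjI allI impI C \<Lambda> bound)
qed

end
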